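(* Let $f:\{0,1\}^n\to\mathbb{R}$ be a submodular function with $f(\mathbf 0)=0$, and let $EE_f$ be its extended envelope epigraph. Let $\mathcal{C}$ be a full-dimensional closed convex set in $\mathbb{R}^{n+1}$ including $EE_f$. Then $\mathcal{C}$ is a $\mathrm{hypo}(f)$-free set if and only if $\mathcal{C}$ is $\mathrm{gra}(f)$-free. Moreover, $\mathcal{C}$ is a maximal $\mathrm{hypo}(f)$-free set if and only if $\mathcal{C}$ is a polyhedron and there is at least one point of $\mathrm{gra}(f)$ in the relative interior of each facet of $\mathcal{C}$.
   Context: $f:\{0,1\}^n\to\mathbb{R}$ is submodular if $f(x)+f(y)\ge f(x\vee y)+f(x\wedge y)$ for all $x,y\in\{0,1\}^n$ (componentwise max and min). For vectors $s,x\in\mathbb{R}^n$, $sx$ denotes the inner product. The extended polymatroid is $EPM_f:=\{s\in\mathbb{R}^n: sx\le f(x)\ \forall x\in\{0,1\}^n\}$, and $\mathrm{ext}(EPM_f)$ is its set of vertices. The extended envelope epigraph is $EE_f:=\{(x,t)\in\mathbb{R}^n\times\mathbb{R}: sx\le t\ \forall s\in \mathrm{ext}(EPM_f)\}$. Graph: $\mathrm{gra}(f):=\{(x,t)\in\{0,1\}^n\times\mathbb{R}: f(x)=t\}$. Hypograph: $\mathrm{hypo}(f):=\{(x,t)\in\{0,1\}^n\times\mathbb{R}: f(x)\ge t\}$. For a set $\mathcal{S}\subseteq\mathbb{R}^p$, a closed convex set $\mathcal{C}\subseteq\mathbb{R}^p$ is $\mathcal{S}$-free if $\mathrm{int}(\mathcal{C})\cap\mathcal{S}=\varnothing$;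 it is maximal $\mathcal{S}$-free if it is not properly contained in another $\mathcal{S}$-free set.
   Formalization: In the second equivalence the right-hand side also requires that C be hypo(f)-free; without this the claim is false, e.g. C = R^{n+1} is a polyhedron with no facets but is not hypo(f)-free. *)

theory Defs
  imports "HOL-Analysis.Analysis"
begin

definition cube :: "(real ^ 'n) set"
  where "cube = {x. \<forall>i. x $ i \<in> {0, 1}}"

(* A function on the cube is given as a total function on real ^ 'n; every definition
   below refers to its values on the cube only.  sup and inf on real ^ 'n are the
   componentwise maximum and minimum. *)

definition submodular :: "(real ^ 'n \<Rightarrow> real) \<Rightarrow> bool"
  where "submodular f \<longleftrightarrow>
    (\<forall>x\<in>cube. \<forall>y\<in>cube. f x + f y \<ge> f (sup x y) + f (inf x y))"

definition EPM :: "(real ^ 'n \<Rightarrow> real) \<Rightarrow> (real ^ 'n) set"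
  where "EPM f = {s. \<forall>x\<in>cube. s \<bullet> x \<le> f x}"

definition EE :: "(real ^ 'n \<Rightarrow> real) \<Rightarrow> ((real ^ 'n) \<times> real) set"
  where "EE f = {(x, t). \<forall>s. s extreme_point_of EPM f \<longrightarrow> s \<bullet> x \<le> t}"

definition gra :: "(real ^ 'n \<Rightarrow> real) \<Rightarrow> ((real ^ 'n) \<times> real) set"
  where "gra f = {(x, t). x \<in> cube \<and> f x = t}"

definition hypo :: "(real ^ 'n \<Rightarrow> real) \<Rightarrow> ((real ^ 'n) \<times> real) set"
  where "hypo f = {(x, t). x \<in> cube \<and> f x \<ge> t}"

definition free_set :: "'a::euclidean_space set \<Rightarrow> 'a set \<Rightarrow> bool"
  where "free_set S C \<longleftrightarrow> closed C \<and> convex C \<and> interior C \<inter> S = {}"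

definition maximal_free_set :: "'a::euclidean_space set \<Rightarrow> 'a set \<Rightarrow> bool"
  where "maximal_free_set S C \<longleftrightarrow>
    free_set S C \<and> \<not> (\<exists>D. free_set S D \<and> C \<subset> D)"

end

theory Submission
  imports Defs
begin

text \<open>
  Three facts about \<^term>\<open>f\<close> drive the proof.  The cube is finite, so \<^term>\<open>gra f\<close> is finite.  Every
  vertex of \<^term>\<open>EPM f\<close> satisfies the inequalities that define \<^term>\<open>EPM f\<close>, so \<^term>\<open>gra f\<close> lies
  in \<^term>\<open>EE f\<close>, hence in \<^term>\<open>C\<close>.  Finally \<^term>\<open>EE f\<close> is closed under raising the last
  coordinate, so the closed convex set \<^term>\<open>C\<close> contains an upward ray and is therefore itself
  closed under raising the last coordinate; so is its interior.  A point of the hypograph in the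
  interior of \<^term>\<open>C\<close> can thus be lifted to a point of the graph in the interior, which is the
  first claim.

  For the second claim, let \<^term>\<open>C\<close> be maximal.  Choose for each point of the finite graph a
  half-space that contains \<^term>\<open>C\<close> and does not have this point in its interior.  Half-spaces
  that contain \<^term>\<open>C\<close> are closed under raising the last coordinate, so the intersection of the
  chosen ones is still free of the whole hypograph, and by maximality it equals \<^term>\<open>C\<close>
  (lemma \<open>maximal_free_eq_Inter_halfspaces\<close>).  Hence \<^term>\<open>C\<close> is a polyhedron.  If some facet
  \<^term>\<open>F\<close> had no graph point in its relative interior, every graph point would lie on a facet other
  than \<^term>\<open>F\<close>, and the half-spaces of these other facets could be chosen.  Their intersection
  is again \<^term>\<open>C\<close>; but a relative interior point of \<^term>\<open>F\<close> lies strictly inside all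
  of them, although it is a boundary point of \<^term>\<open>C\<close>.

  Conversely, suppose that each facet has a graph point in its relative interior, and that a
  hypograph-free \<^term>\<open>D\<close> contains \<^term>\<open>C\<close> and a further point \<^term>\<open>d\<close>.  A segment from the interior
  of \<^term>\<open>C\<close> to \<^term>\<open>d\<close> leaves \<^term>\<open>C\<close> through a facet.  A hyperplane supporting \<^term>\<open>D\<close> at the
  graph point of this facet contains the whole facet, so the segment crosses it and \<^term>\<open>d\<close> ends
  up on the wrong side, outside \<^term>\<open>D\<close>: a contradiction (lemma \<open>maximal_free_if_facets_meet\<close>).
\<close>

section \<open>Recession directions of closed convex sets\<close>

text \<open>
  The point \<^term>\<open>c + t *\<^sub>R d\<close> is the limit of the points at parameter \<open>1 / n\<close> on the
  segments from \<^term>\<open>c\<close> to the far point \<open>z + (n * t) *\<^sub>R d\<close> of the ray.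
\<close>

lemma closed_convex_ray_recession:
  fixes C :: "'a::real_normed_vector set"
  assumes "closed C" "convex C"
    and ray: "\<And>t. t \<ge> 0 \<Longrightarrow> z + t *\<^sub>R d \<in> C"
    and "c \<in> C" "t \<ge> 0"
  shows "c + t *\<^sub>R d \<in> C"
proof -
  define e where "e n = inverse (real (Suc n))" for n
  have e0: "e \<longlonglongrightarrow> 0"
    unfolding e_def by (rule LIMSEQ_inverse_real_of_nat)
  have e: "0 < e n" "e n \<le> 1" for n
    by (auto simp: e_def field_simps)
  have mem: "(1 - e n) *\<^sub>R c + e n *\<^sub>R (z + (t / e n) *\<^sub>R d) \<in> C" for n
    using e[of n] assms by (intro convexD) auto
  have eq: "(1 - e n) *\<^sub>R c + e n *\<^sub>R (z + (t / e n) *\<^sub>R d)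
      = (1 - e n) *\<^sub>R c + e n *\<^sub>R z + t *\<^sub>R d" for n
    using e(1)[of n] by (simp add: scaleR_add_right)
  have "(\<lambda>n. (1 - e n) *\<^sub>R c + e n *\<^sub>R z + t *\<^sub>R d)
      \<longlonglongrightarrow> (1 - 0) *\<^sub>R c + 0 *\<^sub>R z + t *\<^sub>R d"
    by (intro tendsto_intros e0)
  from closed_sequentially[OF \<open>closed C\<close> mem[unfolded eq] this] show ?thesis
    by simp
qed

lemma interior_add_recession:
  fixes C :: "'a::real_normed_vector set"
  assumes "\<And>c. c \<in> C \<Longrightarrow> c + v \<in> C" and "p \<in> interior C"
  shows "p + v \<in> interior C"
proof (rule interiorI)
  show "open ((+) v ` interior C)"
    by (intro open_translation open_interior)
  show "p + v \<in> (+) v ` interior C"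
    using assms(2) by (auto simp: add.commute)
  show "(+) v ` interior C \<subseteq> C"
    using assms(1) interior_subset[of C] by (force simp: add.commute)
qed

section \<open>Maximal free sets for finitely many downward rays\<close>

text \<open>
  The hypograph of a function is of this form, with the graph for \<^term>\<open>V\<close> and the upward unit
  vector for \<^term>\<open>d\<close>.
\<close>

definition downward_rays :: "'a::real_vector \<Rightarrow> 'a set \<Rightarrow> 'a set"
  where "downward_rays d V = {v - t *\<^sub>R d | v t. v \<in> V \<and> t \<ge> 0}"

lemma subset_downward_rays: "V \<subseteq> downward_rays d V"
  unfolding downward_rays_def by (force intro: exI[of _ 0])

lemma free_downward_rays_iff:
  fixes C :: "'a::euclidean_space set"
  assumes rec: "\<And>c t. c \<in> C \<Longrightarrow> t \<ge> 0 \<Longrightarrow> c + t *\<^sub>R d \<in> C"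
  shows "free_set (downward_rays d V) C \<longleftrightarrow> free_set V C"
proof -
  have "interior C \<inter> V \<noteq> {}" if "interior C \<inter> downward_rays d V \<noteq> {}"
  proof -
    obtain v t where v: "v \<in> V" "t \<ge> 0" "v - t *\<^sub>R d \<in> interior C"
      using \<open>interior C \<inter> downward_rays d V \<noteq> {}\<close> by (auto simp: downward_rays_def)
    have "v - t *\<^sub>R d + t *\<^sub>R d \<in> interior C"
      by (rule interior_add_recession) (use v rec in auto)
    with v show ?thesis by auto
  qed
  then show ?thesis
    unfolding free_set_def using subset_downward_rays[of V d] by blast
qed

text \<open>
  A half-space that contains \<^term>\<open>C\<close> has \<^term>\<open>d\<close> as a recession direction too.  So the
  intersection on the right has it as well, and by \<open>free_downward_rays_iff\<close> it is free of the
  downward rays as soon as it is free of their tips \<^term>\<open>V\<close>; the half-space chosen at a tip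
  ensures this.
\<close>

lemma maximal_free_eq_Inter_halfspaces:
  fixes C :: "'a::euclidean_space set"
  assumes rec: "\<And>c t. c \<in> C \<Longrightarrow> t \<ge> 0 \<Longrightarrow> c + t *\<^sub>R d \<in> C"
    and "C \<noteq> {}"
    and max: "maximal_free_set (downward_rays d V) C"
    and a: "\<And>v. v \<in> V \<Longrightarrow> a v \<noteq> 0"
    and sub: "\<And>v c. v \<in> V \<Longrightarrow> c \<in> C \<Longrightarrow> a v \<bullet> c \<le> b v"
    and out: "\<And>v. v \<in> V \<Longrightarrow> b v \<le> a v \<bullet> v"
  shows "C = (\<Inter>v\<in>V. {x. a v \<bullet> x \<le> b v})"
proof -
  define D where "D = (\<Inter>v\<in>V. {x. a v \<bullet> x \<le> b v})"
  obtain c where "c \<in> C"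
    using \<open>C \<noteq> {}\<close> by auto
  have ad: "a v \<bullet> d \<le> 0" if "v \<in> V" for v
  proof (rule ccontr)
    assume "\<not> a v \<bullet> d \<le> 0"
    then have pos: "a v \<bullet> d > 0"
      by simp
    \<comment> \<open>At this parameter the ray from \<open>c\<close> has left the half-space of \<open>v\<close> by one unit.\<close>
    define t where "t = (b v - a v \<bullet> c + 1) / (a v \<bullet> d)"
    have "t \<ge> 0"
      using pos sub[OF \<open>v \<in> V\<close> \<open>c \<in> C\<close>] by (simp add: t_def)
    then have "a v \<bullet> (c + t *\<^sub>R d) \<le> b v"
      using sub rec \<open>v \<in> V\<close> \<open>c \<in> C\<close> by blast
    moreover have "a v \<bullet> (c + t *\<^sub>R d) = b v + 1"
      using pos by (simp add: t_def inner_add_right)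
    ultimately show False by simp
  qed
  have recD: "x + t *\<^sub>R d \<in> D" if "x \<in> D" "t \<ge> 0" for x t
  proof -
    have "a v \<bullet> (x + t *\<^sub>R d) \<le> b v" if "v \<in> V" for v
    proof -
      have "t * (a v \<bullet> d) \<le> 0"
        using ad[OF that] \<open>t \<ge> 0\<close> by (rule mult_nonneg_nonpos[rotated])
      moreover have "a v \<bullet> x \<le> b v"
        using that \<open>x \<in> D\<close> by (auto simp: D_def)
      ultimately show ?thesis
        by (simp add: inner_add_right)
    qed
    then show ?thesis
      by (auto simp: D_def)
  qed
  have "v \<notin> interior D" if "v \<in> V" for v
  proof
    assume "v \<in> interior D"
    moreover have "interior D \<subseteq> interior {x. a v \<bullet> x \<le> b v}"
      using that by (intro interior_mono) (auto simp: D_def)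
    ultimately have "a v \<bullet> v < b v"
      using a[OF that] by auto
    with out[OF that] show False by simp
  qed
  moreover have "closed D" "convex D"
    unfolding D_def
    by (auto intro: closed_halfspace_le convex_INT convex_halfspace_le)
  ultimately have "free_set V D"
    by (auto simp: free_set_def)
  then have "free_set (downward_rays d V) D"
    using free_downward_rays_iff[of D d V] recD by blast
  moreover have "C \<subseteq> D"
    using sub by (auto simp: D_def)
  ultimately have "C = D"
    using max unfolding maximal_free_set_def by blast
  then show ?thesis
    by (simp add: D_def)
qed

lemma maximal_free_imp_polyhedron:
  fixes C :: "'a::euclidean_space set"
  assumes rec: "\<And>c t. c \<in> C \<Longrightarrow> t \<ge> 0 \<Longrightarrow> c + t *\<^sub>R d \<in> C"
    and int: "interior C \<noteq> {}"
    and "finite V" "V \<subseteq> C"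
    and max: "maximal_free_set (downward_rays d V) C"
  shows "polyhedron C"
proof -
  have free: "convex C" "interior C \<inter> V = {}"
    using max subset_downward_rays[of V d] by (auto simp: maximal_free_set_def free_set_def)
  have "\<exists>a. a \<noteq> 0 \<and> (\<forall>c\<in>C. a \<bullet> c \<le> a \<bullet> v)" if "v \<in> V" for v
  proof -
    have "v \<in> C" "v \<notin> rel_interior C"
      using that free rel_interior_nonempty_interior[OF int] \<open>V \<subseteq> C\<close> by auto
    then obtain a where "a \<noteq> 0" "\<And>y. y \<in> C \<Longrightarrow> a \<bullet> v \<le> a \<bullet> y"
      using supporting_hyperplane_rel_boundary[OF free(1)] by metis
    then show ?thesis
      by (intro exI[of _ "- a"]) auto
  qed
  then obtain a where a: "\<And>v. v \<in> V \<Longrightarrow> a v \<noteq> 0 \<and> (\<forall>c\<in>C. a v \<bullet> c \<le> a v \<bullet> v)"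
    by metis
  have "C \<noteq> {}"
    using int by auto
  have "C = (\<Inter>v\<in>V. {x. a v \<bullet> x \<le> a v \<bullet> v})"
    using rec a \<open>C \<noteq> {}\<close> max
    by (intro maximal_free_eq_Inter_halfspaces[where d = d]) auto
  then show ?thesis
    using \<open>finite V\<close> by (auto intro: polyhedron_Inter polyhedron_halfspace_le)
qed

lemma facet_subset_proper_face_imp_eq:
  fixes C :: "'a::euclidean_space set"
  assumes "F facet_of C" "G face_of C" "G \<noteq> C" "F \<subseteq> G" "convex C"
  shows "F = G"
proof -
  have "aff_dim G < aff_dim C"
    using assms face_of_aff_dim_lt by blast
  moreover have "F face_of G"
    using assms facet_of_imp_face_of face_of_subset face_of_imp_subset by metis
  moreover have "convex G"
    using assms face_of_imp_convex by blast
  ultimately show ?thesis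
    using face_of_aff_dim_lt[of G F] assms(1) by (force simp: facet_of_def)
qed

text \<open>
  A point of a facet \<^term>\<open>F\<close> outside its relative interior lies on a facet of \<^term>\<open>F\<close>.  This is a
  face of the polyhedron, hence the intersection of the facets that contain it, and these are not
  just \<^term>\<open>F\<close>.
\<close>

lemma boundary_point_on_other_facet:
  fixes C :: "'a::euclidean_space set"
  assumes "polyhedron C" "F facet_of C" "v \<in> C"
    and "v \<notin> rel_interior C" "v \<notin> rel_interior F"
  obtains G where "G facet_of C" "G \<noteq> F" "v \<in> G"
proof (cases "v \<in> F")
  case False
  have "v \<in> rel_frontier C"
    using assms closure_subset by (auto simp: rel_frontier_def)
  then show ?thesis
    using that False rel_frontier_of_polyhedron[OF \<open>polyhedron C\<close>] by auto
next
  case True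
  have F: "F face_of C"
    using assms facet_of_imp_face_of by blast
  then have "polyhedron F"
    using assms face_of_polyhedron_polyhedron by blast
  moreover have "v \<in> rel_frontier F"
    using assms True closure_subset by (auto simp: rel_frontier_def)
  ultimately obtain H where H: "H facet_of F" "v \<in> H"
    using rel_frontier_of_polyhedron by blast
  have "H face_of C"
    using H F facet_of_imp_face_of face_of_trans by blast
  moreover have HF: "H \<noteq> F" "H \<subseteq> F" "H \<noteq> {}"
    using H facet_of_imp_subset by auto
  moreover have "H \<noteq> C"
    using HF facet_of_imp_subset[OF assms(2)] by auto
  ultimately have H_eq: "H = \<Inter>{G. G facet_of C \<and> H \<subseteq> G}"
    using face_of_polyhedron[OF \<open>polyhedron C\<close>] by metis
  have "F \<subseteq> H" if "\<And>G. G facet_of C \<Longrightarrow> H \<subseteq> G \<Longrightarrow> G = F"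
    by (subst H_eq) (use that in blast)
  then obtain G where "G facet_of C" "H \<subseteq> G" "G \<noteq> F"
    using HF by blast
  then show ?thesis
    using that H by blast
qed

text \<open>
  If \<^term>\<open>F\<close> had no point of \<^term>\<open>V\<close> in its relative interior, every point of \<^term>\<open>V\<close>
  would lie on another facet, and by maximality the half-spaces of these other facets would cut
  out \<^term>\<open>C\<close>.  They cannot, because a relative interior point of \<^term>\<open>F\<close> satisfies all of
  their inequalities strictly.
\<close>

lemma maximal_free_imp_facets_meet:
  fixes C :: "'a::euclidean_space set"
  assumes rec: "\<And>c t. c \<in> C \<Longrightarrow> t \<ge> 0 \<Longrightarrow> c + t *\<^sub>R d \<in> C"
    and int: "interior C \<noteq> {}"
    and "finite V" "V \<subseteq> C"
    and max: "maximal_free_set (downward_rays d V) C"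
    and F: "F facet_of C"
  shows "V \<inter> rel_interior F \<noteq> {}"
proof
  assume no: "V \<inter> rel_interior F = {}"
  have free: "convex C" "interior C \<inter> V = {}"
    using max subset_downward_rays[of V d] by (auto simp: maximal_free_set_def free_set_def)
  have poly: "polyhedron C"
    using maximal_free_imp_polyhedron[OF rec int \<open>finite V\<close> \<open>V \<subseteq> C\<close> max] by blast
  have ri: "rel_interior C = interior C"
    using int by (rule rel_interior_nonempty_interior)
  have "\<exists>a. a \<noteq> 0 \<and> (\<forall>c\<in>C. a \<bullet> c \<le> a \<bullet> v)
      \<and> C \<inter> {x. a \<bullet> x = a \<bullet> v} facet_of C \<and> C \<inter> {x. a \<bullet> x = a \<bullet> v} \<noteq> F" if "v \<in> V" for v
  proof -
    have "v \<in> C" "v \<notin> rel_interior C" "v \<notin> rel_interior F"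
      using that free no ri \<open>V \<subseteq> C\<close> by auto
    then obtain G where G: "G facet_of C" "G \<noteq> F" "v \<in> G"
      using boundary_point_on_other_facet[OF poly F] by blast
    then obtain a b where "a \<noteq> 0" "C \<subseteq> {x. a \<bullet> x \<le> b}" "G = C \<inter> {x. a \<bullet> x = b}"
      using facet_of_polyhedron[OF poly] by metis
    with G show ?thesis by blast
  qed
  then obtain a where a: "\<And>v. v \<in> V \<Longrightarrow> a v \<noteq> 0 \<and> (\<forall>c\<in>C. a v \<bullet> c \<le> a v \<bullet> v)
      \<and> C \<inter> {x. a v \<bullet> x = a v \<bullet> v} facet_of C \<and> C \<inter> {x. a v \<bullet> x = a v \<bullet> v} \<noteq> F"
    by metis
  have "C \<noteq> {}"
    using int by auto
  have C: "C = (\<Inter>v\<in>V. {x. a v \<bullet> x \<le> a v \<bullet> v})"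
    using rec a \<open>C \<noteq> {}\<close> max
    by (intro maximal_free_eq_Inter_halfspaces[where d = d]) auto
  have "convex F" "F \<noteq> {}" "F \<subseteq> C"
    using F face_of_imp_convex facet_of_imp_subset unfolding facet_of_def by blast+
  then obtain q where q: "q \<in> rel_interior F" "q \<in> F" "q \<in> C"
    using rel_interior_eq_empty rel_interior_subset by blast
  have strict: "a v \<bullet> q < a v \<bullet> v" if "v \<in> V" for v
  proof (rule ccontr)
    let ?G = "C \<inter> {x. a v \<bullet> x = a v \<bullet> v}"
    assume "\<not> a v \<bullet> q < a v \<bullet> v"
    then have "q \<in> ?G"
      using a[OF that] q by force
    moreover have "?G face_of C"
      using a[OF that] facet_of_imp_face_of by blast
    ultimately have "F \<subseteq> ?G"
      using subset_of_face_of[of ?G C F] q \<open>F \<subseteq> C\<close> by blast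
    moreover have "?G \<noteq> C"
      using a[OF that] by force
    ultimately have "F = ?G"
      using facet_subset_proper_face_imp_eq F \<open>?G face_of C\<close> \<open>convex C\<close> by blast
    with a[OF that] show False by simp
  qed
  have "q \<in> interior C"
  proof (rule interiorI)
    show "open (\<Inter>v\<in>V. {x. a v \<bullet> x < a v \<bullet> v})"
      using \<open>finite V\<close> by (intro open_INT) (auto intro: open_halfspace_lt)
    show "q \<in> (\<Inter>v\<in>V. {x. a v \<bullet> x < a v \<bullet> v})"
      using strict by auto
    show "(\<Inter>v\<in>V. {x. a v \<bullet> x < a v \<bullet> v}) \<subseteq> C"
      by (subst C) force
  qed
  moreover have "F \<noteq> C"
    using F by auto
  ultimately show False
    using face_of_disjoint_rel_interior[of F C] F facet_of_imp_face_of q ri by blast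
qed

text \<open>
  Let \<^term>\<open>D\<close> strictly contain \<^term>\<open>C\<close> and let a segment from \<^term>\<open>c\<close> in the interior of
  \<^term>\<open>C\<close> to \<^term>\<open>d\<close> in \<^term>\<open>D - C\<close> cross the boundary of \<^term>\<open>C\<close> at \<^term>\<open>q\<close> on the facet
  \<^term>\<open>F\<close>.  A supporting hyperplane of \<^term>\<open>D\<close> at a point in the relative interior of
  \<^term>\<open>F\<close> contains \<^term>\<open>F\<close>, hence \<^term>\<open>q\<close>.  It has \<^term>\<open>c\<close> strictly on its inner side, so
  \<^term>\<open>d\<close> beyond \<^term>\<open>q\<close> is strictly on its outer side, although \<^term>\<open>d\<close> is in \<^term>\<open>D\<close>.
\<close>

lemma maximal_free_if_facets_meet:
  fixes C :: "'a::euclidean_space set"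
  assumes free: "free_set S C" and poly: "polyhedron C" and int: "interior C \<noteq> {}"
    and meet: "\<And>F. F facet_of C \<Longrightarrow> S \<inter> rel_interior F \<noteq> {}"
  shows "maximal_free_set S C"
  unfolding maximal_free_set_def
proof (intro conjI free notI)
  assume "\<exists>D. free_set S D \<and> C \<subset> D"
  then obtain D d where D: "free_set S D" "C \<subseteq> D" "d \<in> D" "d \<notin> C"
    by auto
  then have "convex D"
    by (simp add: free_set_def)
  obtain c where c: "c \<in> interior C"
    using int by auto
  then have "c \<in> C"
    using interior_subset by auto
  have "closed_segment c d \<inter> frontier C \<noteq> {}"
    using \<open>c \<in> C\<close> D(4) by (intro connected_Int_frontier) auto
  then obtain q where q: "q \<in> closed_segment c d" "q \<in> frontier C"
    by auto
  have "q \<in> C"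
    using q(2) poly frontier_subset_closed polyhedron_imp_closed by blast
  have "rel_frontier C = frontier C"
    using int by (rule rel_frontier_nonempty_interior)
  then obtain F where F: "F facet_of C" "q \<in> F"
    using q(2) rel_frontier_of_polyhedron[OF poly] by auto
  obtain p where p: "p \<in> S" "p \<in> rel_interior F"
    using meet[OF F(1)] by auto
  have "F \<subseteq> D"
    using F(1) D(2) facet_of_imp_subset by blast
  then have "p \<in> D"
    using p rel_interior_subset by blast
  have cD: "c \<in> interior D"
    using c interior_mono[OF D(2)] by blast
  then have riD: "rel_interior D = interior D"
    by (intro rel_interior_nonempty_interior) blast
  have "p \<notin> rel_interior D"
    using p(1) D(1) riD by (auto simp: free_set_def)
  then obtain a where a: "\<And>y. y \<in> D \<Longrightarrow> a \<bullet> p \<le> a \<bullet> y"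
      "\<And>y. y \<in> rel_interior D \<Longrightarrow> a \<bullet> p < a \<bullet> y"
    using supporting_hyperplane_rel_boundary[OF \<open>convex D\<close> \<open>p \<in> D\<close>] by metis
  have "D \<inter> {x. a \<bullet> x = a \<bullet> p} face_of D"
    using a(1) \<open>convex D\<close> by (intro face_of_Int_supporting_hyperplane_ge) auto
  then have "F \<subseteq> D \<inter> {x. a \<bullet> x = a \<bullet> p}"
    by (rule subset_of_face_of) (use p \<open>p \<in> D\<close> \<open>F \<subseteq> D\<close> in blast)+
  then have aq: "a \<bullet> q = a \<bullet> p"
    using F(2) by auto
  obtain u where u: "0 \<le> u" "u \<le> 1" "q = (1 - u) *\<^sub>R c + u *\<^sub>R d"
    using q(1) by (auto simp: closed_segment_def)
  have "u < 1"
    using u \<open>q \<in> C\<close> D(4) by (cases "u = 1") auto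
  have "(1 - u) * (a \<bullet> p) < (1 - u) * (a \<bullet> c)"
    using \<open>u < 1\<close> a(2) cD riD by auto
  moreover have "u * (a \<bullet> p) \<le> u * (a \<bullet> d)"
    using u(1) a(1)[OF D(3)] by (rule mult_left_mono[rotated])
  ultimately have "a \<bullet> p < a \<bullet> q"
    by (simp add: u(3) inner_add_right algebra_simps)
  with aq show False by simp
qed

section \<open>The graph, the hypograph and the extended envelope epigraph\<close>

lemma finite_cube: "finite (cube :: (real ^ 'n) set)"
proof -
  have "cube \<subseteq> range (\<lambda>A. (\<chi> i. if i \<in> A then 1 else 0) :: real ^ 'n)"
  proof
    fix x :: "real ^ 'n"
    assume "x \<in> cube"
    then have "x = (\<chi> i. if i \<in> {i. x $ i = 1} then 1 else 0)"
      by (auto simp: cube_def vec_eq_iff)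
    then show "x \<in> range (\<lambda>A. (\<chi> i. if i \<in> A then 1 else 0) :: real ^ 'n)"
      by blast
  qed
  then show ?thesis
    by (rule finite_subset) simp
qed

lemma finite_gra: "finite (gra f)"
proof -
  have "gra f = (\<lambda>x. (x, f x)) ` cube"
    by (auto simp: gra_def)
  then show ?thesis
    by (simp add: finite_cube)
qed

lemma hypo_eq_downward_rays: "hypo f = downward_rays (0, 1) (gra f)"
proof -
  have "\<exists>t'. t = f x - t' \<and> 0 \<le> t'" if "t \<le> f x" for x t
    using that by (intro exI[of _ "f x - t"]) auto
  then show ?thesis
    by (auto simp: hypo_def downward_rays_def gra_def)
qed

lemma gra_subset_EE: "gra f \<subseteq> EE f"
  by (auto simp: gra_def EE_def EPM_def extreme_point_of_def)

lemma EE_add_up: "p \<in> EE f \<Longrightarrow> t \<ge> 0 \<Longrightarrow> p + t *\<^sub>R (0, 1) \<in> EE f"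
  by (force simp: EE_def)

lemma gra_nonempty: "gra f \<noteq> {}"
proof -
  have "(0, f 0) \<in> gra f"
    by (simp add: gra_def cube_def)
  then show ?thesis by blast
qed

section \<open>Hypograph-free and graph-free sets\<close>

theorem theorem3:
  fixes f :: "real ^ 'n \<Rightarrow> real"
    and C :: "((real ^ 'n) \<times> real) set"
  assumes "submodular f"
    and "f 0 = 0"
    and "closed C"
    and "convex C"
    and "aff_dim C = int DIM((real ^ 'n) \<times> real)"
    and "EE f \<subseteq> C"
  shows "(free_set (hypo f) C \<longleftrightarrow> free_set (gra f) C) \<and>
    (maximal_free_set (hypo f) C \<longleftrightarrow>
      free_set (hypo f) C \<and> polyhedron C \<and>
      (\<forall>F. F facet_of C \<longrightarrow> (\<exists>p \<in> gra f. p \<in> rel_interior F)))"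
proof -
  have graC: "gra f \<subseteq> C"
    using gra_subset_EE assms(6) by blast
  have "C \<noteq> {}"
    using graC gra_nonempty by blast
  then have int: "interior C \<noteq> {}"
    using rel_interior_eq_empty[OF assms(4)] interior_rel_interior[OF assms(5)] by simp
  obtain z where "z \<in> EE f"
    using gra_nonempty gra_subset_EE by blast
  then have "z + t *\<^sub>R (0, 1) \<in> C" if "t \<ge> 0" for t
    using that EE_add_up assms(6) by blast
  then have rec: "c + t *\<^sub>R (0, 1) \<in> C" if "c \<in> C" "t \<ge> 0" for c t
    using closed_convex_ray_recession[OF assms(3,4)] that by blast
  have free_iff: "free_set (hypo f) C \<longleftrightarrow> free_set (gra f) C"
    unfolding hypo_eq_downward_rays using rec by (rule free_downward_rays_iff)
  have "polyhedron C \<and> (\<forall>F. F facet_of C \<longrightarrow> gra f \<inter> rel_interior F \<noteq> {})"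
    if "maximal_free_set (hypo f) C"
    using that unfolding hypo_eq_downward_rays
    using maximal_free_imp_polyhedron[OF rec int finite_gra graC]
      maximal_free_imp_facets_meet[OF rec int finite_gra graC] by blast
  moreover have "maximal_free_set (hypo f) C"
    if "free_set (hypo f) C" "polyhedron C"
      "\<And>F. F facet_of C \<Longrightarrow> gra f \<inter> rel_interior F \<noteq> {}"
    using that int subset_downward_rays[of "gra f" "(0, 1)"]
    by (intro maximal_free_if_facets_meet) (auto simp: hypo_eq_downward_rays)
  moreover have "free_set (hypo f) C" if "maximal_free_set (hypo f) C"
    using that by (simp add: maximal_free_set_def)
  ultimately show ?thesis
    using free_iff by blast
qed

end
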